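(* (i) For $H\in(0,1/2)$, the statistic $$\widetilde a_k^2=2^{k(2\widetilde H_k-1)}T^{-2\widetilde H_k}V_{2^k}^{H,2}$$ is a strongly consistent estimator of $a^2$, i.e. $\widetilde a_k^2\to a^2$ almost surely as $k\to\infty$. (ii) For $H\in(1/4,1/2)$, the statistic $$\widetilde b_k^2=\frac{2^{1-2\widetilde H_k^{(2)}}V_{2^k}^{H,2}-V_{2^{k+1}}^{H,2}}{\left(2^{1-2\widetilde H_k^{(2)}}-1\right)T}$$ is a strongly consistent estimator of $b^2$, i.e. $\widetilde b_k^2\to b^2$ almost surely as $k\to\infty$.
   Context: Mixed model: $M_t^H=aB_t^H+bW_t$, $t\in[0,T]$, where $T>0$, $a>0$, $b>0$, $W$ is a standard Wiener process and $B^H$ is a fractional Brownian motion with Hurst parameter $H$ (centered Gaussian, $\mathsf{E}[B^H_tB^H_s]=\frac12(t^{2H}+s^{2H}-|t-s|^{2H})$), independent of $W$. For $n\ge1$, $\Delta_i^nX=X_{T(i+1)/n}-X_{Ti/n}$, $i=0,\dots,n-1$; $V_n^{H,2}=\sum_{i=0}^{n-1}(\Delta_i^nM^H)^2$; $U_k^{H,2}=V_{2^k}^{H,2}-V_{2^{k+1}}^{H,2}$; $\log_{2+}x=\log_2x$ for $x>0$ and $\log_{2+}x=0$ for $x\le0$. The estimators of $H$ used are $$\widetilde H_k=\frac12\left(\log_2\frac{V_{2^k}^{H,2}}{V_{2^{k+1}}^{H,2}}+1\right),\qquad \widetilde H_k^{(2)}=\frac12\left(\log_{2+}\frac{U_k^{H,2}}{U_{k+1}^{H,2}}+1\right).$$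 *)

theory Defs
  imports "HOL-Probability.Probability"
begin

(* Degenerate (almost surely constant) variables count as Gaussian: B 0 = 0 a.s. for
   fractional Brownian motion, and linear combinations of a Gaussian process may vanish. *)
definition gaussian_rv :: "'a measure \<Rightarrow> ('a \<Rightarrow> real) \<Rightarrow> bool" where
  "gaussian_rv M X \<longleftrightarrow>
     X \<in> borel_measurable M \<and>
     ((\<exists>c. AE \<omega> in M. X \<omega> = c) \<or>
      (\<exists>\<mu> \<sigma>. \<sigma> > 0 \<and> distributed M lborel X (normal_density \<mu> \<sigma>)))"

definition gaussian_process :: "'a measure \<Rightarrow> real set \<Rightarrow> (real \<Rightarrow> 'a \<Rightarrow> real) \<Rightarrow> bool" where
  "gaussian_process M I X \<longleftrightarrow>
     (\<forall>J c. finite J \<longrightarrow> J \<subseteq> I \<longrightarrow> gaussian_rv M (\<lambda>\<omega>. \<Sum>t\<in>J. c t * X t \<omega>))"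

(* Processes are indexed by the whole real line, but only their values at times in the
   index set I (a subset of the half-line of nonnegative reals) are constrained.
   No path continuity is required of fractional Brownian motion. *)
definition fractional_brownian_motion ::
    "'a measure \<Rightarrow> real set \<Rightarrow> real \<Rightarrow> (real \<Rightarrow> 'a \<Rightarrow> real) \<Rightarrow> bool" where
  "fractional_brownian_motion M I H B \<longleftrightarrow>
     0 < H \<and> H < 1 \<and>
     gaussian_process M I B \<and>
     (\<forall>t\<in>I. (\<integral>\<omega>. B t \<omega> \<partial>M) = 0) \<and>
     (\<forall>t\<in>I. \<forall>s\<in>I. (\<integral>\<omega>. B t \<omega> * B s \<omega> \<partial>M) =
        (t powr (2 * H) + s powr (2 * H) - \<bar>t - s\<bar> powr (2 * H)) / 2)"

definition wiener_process :: "'a measure \<Rightarrow> real set \<Rightarrow> (real \<Rightarrow> 'a \<Rightarrow> real) \<Rightarrow> bool" where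
  "wiener_process M I W \<longleftrightarrow>
     (\<forall>t\<in>I. W t \<in> borel_measurable M) \<and>
     (AE \<omega> in M. W 0 \<omega> = 0) \<and>
     (\<forall>n t. (\<forall>i\<le>n. t i \<in> I) \<longrightarrow> (\<forall>i<n. t i \<le> t (Suc i)) \<longrightarrow>
        prob_space.indep_vars M (\<lambda>_. borel)
          (\<lambda>i \<omega>. W (t (Suc i)) \<omega> - W (t i) \<omega>) {..<n::nat}) \<and>
     (\<forall>s\<in>I. \<forall>t\<in>I. s < t \<longrightarrow>
        distributed M lborel (\<lambda>\<omega>. W t \<omega> - W s \<omega>) (normal_density 0 (sqrt (t - s)))) \<and>
     (AE \<omega> in M. continuous_on I (\<lambda>t. W t \<omega>))"

(* Independence of the two processes as families, not merely at each fixed time: the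
   sigma-algebras they generate are those of the maps into the product space. *)
definition independent_processes ::
    "'a measure \<Rightarrow> real set \<Rightarrow> (real \<Rightarrow> 'a \<Rightarrow> real) \<Rightarrow> (real \<Rightarrow> 'a \<Rightarrow> real) \<Rightarrow> bool" where
  "independent_processes M I X Y \<longleftrightarrow>
     prob_space.indep_var M
       (PiM I (\<lambda>_. borel)) (\<lambda>\<omega>. \<lambda>t\<in>I. X t \<omega>)
       (PiM I (\<lambda>_. borel)) (\<lambda>\<omega>. \<lambda>t\<in>I. Y t \<omega>)"

definition mixed_path ::
    "real \<Rightarrow> real \<Rightarrow> (real \<Rightarrow> 'a \<Rightarrow> real) \<Rightarrow> (real \<Rightarrow> 'a \<Rightarrow> real) \<Rightarrow> 'a \<Rightarrow> real \<Rightarrow> real" where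
  "mixed_path a b B W \<omega> = (\<lambda>t. a * B t \<omega> + b * W t \<omega>)"

(* The statistics below are functions of the horizon T and of the observed path x alone;
   the unknown parameters H, a, b do not enter them. *)

definition increment :: "real \<Rightarrow> (real \<Rightarrow> real) \<Rightarrow> nat \<Rightarrow> nat \<Rightarrow> real" where
  "increment T x n i = x (T * real (i + 1) / real n) - x (T * real i / real n)"

definition V_stat :: "real \<Rightarrow> (real \<Rightarrow> real) \<Rightarrow> nat \<Rightarrow> real" where
  "V_stat T x n = (\<Sum>i<n. (increment T x n i)\<^sup>2)"

definition U_stat :: "real \<Rightarrow> (real \<Rightarrow> real) \<Rightarrow> nat \<Rightarrow> real" where
  "U_stat T x k = V_stat T x (2 ^ k) - V_stat T x (2 ^ (k + 1))"

definition log2_plus :: "real \<Rightarrow> real" where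
  "log2_plus x = (if x > 0 then log 2 x else 0)"

definition H_est :: "real \<Rightarrow> (real \<Rightarrow> real) \<Rightarrow> nat \<Rightarrow> real" where
  "H_est T x k = (log 2 (V_stat T x (2 ^ k) / V_stat T x (2 ^ (k + 1))) + 1) / 2"

definition H2_est :: "real \<Rightarrow> (real \<Rightarrow> real) \<Rightarrow> nat \<Rightarrow> real" where
  "H2_est T x k = (log2_plus (U_stat T x k / U_stat T x (k + 1)) + 1) / 2"

definition a_sq_est :: "real \<Rightarrow> (real \<Rightarrow> real) \<Rightarrow> nat \<Rightarrow> real" where
  "a_sq_est T x k =
     2 powr (real k * (2 * H_est T x k - 1)) * T powr (- 2 * H_est T x k) * V_stat T x (2 ^ k)"

definition b_sq_est :: "real \<Rightarrow> (real \<Rightarrow> real) \<Rightarrow> nat \<Rightarrow> real" where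
  "b_sq_est T x k =
     (2 powr (1 - 2 * H2_est T x k) * V_stat T x (2 ^ k) - V_stat T x (2 ^ (k + 1))) /
     ((2 powr (1 - 2 * H2_est T x k) - 1) * T)"

end

theory Submission
  imports Defs
begin

text \<open>Along \<open>n = 2\<^sup>k\<close> the quadratic variation splits as \<open>V = a\<^sup>2 T\<^sup>2\<^sup>H q\<^sup>k + b\<^sup>2 T + e\<^sub>k\<close> with
  \<open>q = 2\<^sup>1\<^sup>-\<^sup>2\<^sup>H > 1\<close>. The error \<open>e\<^sub>k\<close> collects the centred quadratic variation of the fractional part
  (second moment of order \<open>n\<^sup>1\<^sup>-\<^sup>4\<^sup>H\<close>), that of the Wiener part (order \<open>n\<^sup>-\<^sup>1\<close>) and the cross variation
  (order \<open>n\<^sup>-\<^sup>2\<^sup>H\<close>). Second moments that decay geometrically in \<open>k\<close> are summable, which gives almost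
  sure convergence with any polynomial rate. Part (i) needs only \<open>k e\<^sub>k / q\<^sup>k \<longlonglongrightarrow> 0\<close>, because an error of
  the exponent estimate is amplified by the factor \<open>k\<close>. In part (ii) the constant \<open>b\<^sup>2 T\<close> cancels in the
  differences \<open>U\<close>, but \<open>e\<^sub>k \<longlonglongrightarrow> 0\<close> itself is needed, and this is where \<open>H > 1/4\<close> enters.\<close>

section \<open>Moments of centred Gaussian variables\<close>

text \<open>Degenerate variables count as Gaussian, hence two cases. A constant with mean zero
  vanishes almost surely; otherwise the second and fourth moments of the normal density are
  \<open>\<sigma>^2\<close> and \<open>3 * \<sigma>^4\<close>. Kurtosis 3, written without division,
  covers both cases.\<close>

lemma (in prob_space) centered_gaussian_rv_moments:
  assumes "gaussian_rv M X" "expectation X = 0"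
  shows "integrable M (\<lambda>\<omega>. X \<omega> ^ k)"
    and "expectation (\<lambda>\<omega>. X \<omega> ^ 4) = 3 * (expectation (\<lambda>\<omega>. X \<omega> ^ 2))\<^sup>2"
proof -
  have X [measurable]: "X \<in> borel_measurable M"
    using assms(1) by (simp add: gaussian_rv_def)
  have "integrable M (\<lambda>\<omega>. X \<omega> ^ k) \<and>
      expectation (\<lambda>\<omega>. X \<omega> ^ 4) = 3 * (expectation (\<lambda>\<omega>. X \<omega> ^ 2))\<^sup>2"
  proof (cases "\<exists>c. AE \<omega> in M. X \<omega> = c")
    case True
    then obtain c where c: "AE \<omega> in M. X \<omega> = c" by blast
    have "expectation X = expectation (\<lambda>_. c)"
      by (intro integral_cong_AE) (use c in auto)
    then have "c = 0" using assms(2) prob_space by simp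
    with c have X0: "AE \<omega> in M. X \<omega> = 0" by simp
    have "integrable M (\<lambda>\<omega>. X \<omega> ^ k) \<longleftrightarrow> integrable M (\<lambda>_. 0 ^ k :: real)"
      by (intro integrable_cong_AE) (use X0 in auto)
    moreover have "expectation (\<lambda>\<omega>. X \<omega> ^ 4) = expectation (\<lambda>_. 0)"
      by (intro integral_cong_AE) (use X0 in auto)
    moreover have "expectation (\<lambda>\<omega>. X \<omega> ^ 2) = expectation (\<lambda>_. 0)"
      by (intro integral_cong_AE) (use X0 in auto)
    ultimately show ?thesis by simp
  next
    case False
    then obtain \<mu> \<sigma> where \<sigma>: "\<sigma> > 0" and D': "distributed M lborel X (normal_density \<mu> \<sigma>)"
      using assms(1) unfolding gaussian_rv_def by blast
    have "\<mu> = 0"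
      using normal_distributed_expectation[OF \<sigma> D'] assms(2) by simp
    with D' have D: "distributed M lborel X (normal_density 0 \<sigma>)" by simp
    have "integrable M (\<lambda>\<omega>. X \<omega> ^ k)"
      using distributed_integrable[OF D, of "\<lambda>x. x ^ k"] integrable_normal_moment[OF \<sigma>, of 0 k]
      by simp
    moreover have "expectation (\<lambda>\<omega>. X \<omega> ^ (2 * m)) = fact (2 * m) / ((2 / \<sigma>\<^sup>2) ^ m * fact m)" for m
      using distributed_integral[OF D, of "\<lambda>x. x ^ (2 * m)"] integral_normal_moment_even[OF \<sigma>, of 0 m]
      by simp
    from this[of 1] this[of 2]
    have "expectation (\<lambda>\<omega>. X \<omega> ^ 4) = 3 * (expectation (\<lambda>\<omega>. X \<omega> ^ 2))\<^sup>2"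
      by (simp add: fact_numeral power_divide)
    ultimately show ?thesis by blast
  qed
  then show "integrable M (\<lambda>\<omega>. X \<omega> ^ k)"
    and "expectation (\<lambda>\<omega>. X \<omega> ^ 4) = 3 * (expectation (\<lambda>\<omega>. X \<omega> ^ 2))\<^sup>2"
    by simp_all
qed

lemma (in prob_space) integrable_mult_square_integrable:
  fixes X Y :: "'a \<Rightarrow> real"
  assumes "X \<in> borel_measurable M" "Y \<in> borel_measurable M"
    and "integrable M (\<lambda>\<omega>. X \<omega> ^ 2)" "integrable M (\<lambda>\<omega>. Y \<omega> ^ 2)"
  shows "integrable M (\<lambda>\<omega>. X \<omega> * Y \<omega>)"
proof (rule Bochner_Integration.integrable_bound)
  show "integrable M (\<lambda>\<omega>. X \<omega> ^ 2 + Y \<omega> ^ 2)" using assms by simp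
  show "(\<lambda>\<omega>. X \<omega> * Y \<omega>) \<in> borel_measurable M" using assms by simp
  have "\<bar>x * y\<bar> \<le> x\<^sup>2 + y\<^sup>2" for x y :: real
    using sum_squares_bound[of "\<bar>x\<bar>" "\<bar>y\<bar>"] abs_ge_zero[of "x * y"]
    unfolding abs_mult power2_abs by linarith
  then show "AE \<omega> in M. norm (X \<omega> * Y \<omega>) \<le> norm (X \<omega> ^ 2 + Y \<omega> ^ 2)" by simp
qed

text \<open>Wick's formula for two pairs, by polarisation: \<open>12 x\<^sup>2 y\<^sup>2\<close> equals
  \<open>(x + y)\<^sup>4 + (x - y)\<^sup>4\<close> minus \<open>2 x\<^sup>4 + 2 y\<^sup>4\<close>, so fourth moments of linear combinations suffice.\<close>
lemma (in prob_space) gaussian_pair_square_moment: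
  assumes G: "\<And>c d. gaussian_rv M (\<lambda>\<omega>. c * X \<omega> + d * Y \<omega>)"
    and "expectation X = 0" "expectation Y = 0"
  shows "integrable M (\<lambda>\<omega>. X \<omega> ^ 2 * Y \<omega> ^ 2)"
    and "expectation (\<lambda>\<omega>. X \<omega> ^ 2 * Y \<omega> ^ 2) =
      expectation (\<lambda>\<omega>. X \<omega> ^ 2) * expectation (\<lambda>\<omega>. Y \<omega> ^ 2) + 2 * (expectation (\<lambda>\<omega>. X \<omega> * Y \<omega>))\<^sup>2"
proof -
  have GX: "gaussian_rv M X" and GY: "gaussian_rv M Y"
    using G[of 1 0] G[of 0 1] by simp_all
  note mX = centered_gaussian_rv_moments[OF GX assms(2)]
  note mY = centered_gaussian_rv_moments[OF GY assms(3)]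
  have [measurable]: "X \<in> borel_measurable M" "Y \<in> borel_measurable M"
    using GX GY by (simp_all add: gaussian_rv_def)
  have iX: "integrable M X" and iY: "integrable M Y" using mX(1)[of 1] mY(1)[of 1] by simp_all
  have iXY: "integrable M (\<lambda>\<omega>. X \<omega> * Y \<omega>)"
    using mX(1) mY(1) by (intro integrable_mult_square_integrable) auto
  show iX2Y2: "integrable M (\<lambda>\<omega>. X \<omega> ^ 2 * Y \<omega> ^ 2)"
    using mX(1)[of 4] mY(1)[of 4]
    by (intro integrable_mult_square_integrable) (auto simp flip: power_mult)
  have Gp: "gaussian_rv M (\<lambda>\<omega>. X \<omega> + Y \<omega>)" and Gm: "gaussian_rv M (\<lambda>\<omega>. X \<omega> - Y \<omega>)"
    using G[of 1 1] G[of 1 "-1"] by simp_all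
  have mplus: "integrable M (\<lambda>\<omega>. (X \<omega> + Y \<omega>) ^ k)"
      "expectation (\<lambda>\<omega>. (X \<omega> + Y \<omega>) ^ 4) = 3 * (expectation (\<lambda>\<omega>. (X \<omega> + Y \<omega>) ^ 2))\<^sup>2" for k
    using centered_gaussian_rv_moments[OF Gp] iX iY assms(2,3) by simp_all
  have mminus: "integrable M (\<lambda>\<omega>. (X \<omega> - Y \<omega>) ^ k)"
      "expectation (\<lambda>\<omega>. (X \<omega> - Y \<omega>) ^ 4) = 3 * (expectation (\<lambda>\<omega>. (X \<omega> - Y \<omega>) ^ 2))\<^sup>2" for k
    using centered_gaussian_rv_moments[OF Gm] iX iY assms(2,3) by simp_all
  define x where "x = expectation (\<lambda>\<omega>. X \<omega> ^ 2)"
  define y where "y = expectation (\<lambda>\<omega>. Y \<omega> ^ 2)"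
  define c where "c = expectation (\<lambda>\<omega>. X \<omega> * Y \<omega>)"
  have p2: "expectation (\<lambda>\<omega>. (X \<omega> + Y \<omega>) ^ 2) = x + y + 2 * c"
    unfolding x_def y_def c_def power2_sum using mX(1)[of 2] mY(1)[of 2] iXY
    by (simp add: mult.assoc)
  have m2: "expectation (\<lambda>\<omega>. (X \<omega> - Y \<omega>) ^ 2) = x + y - 2 * c"
    unfolding x_def y_def c_def power2_diff using mX(1)[of 2] mY(1)[of 2] iXY
    by (simp add: mult.assoc)
  have "12 * expectation (\<lambda>\<omega>. X \<omega> ^ 2 * Y \<omega> ^ 2) =
      expectation (\<lambda>\<omega>. 12 * (X \<omega> ^ 2 * Y \<omega> ^ 2))" by simp
  also have "(\<lambda>\<omega>. 12 * (X \<omega> ^ 2 * Y \<omega> ^ 2)) =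
      (\<lambda>\<omega>. (X \<omega> + Y \<omega>) ^ 4 + (X \<omega> - Y \<omega>) ^ 4 - 2 * X \<omega> ^ 4 - 2 * Y \<omega> ^ 4)"
    by (rule ext) (simp add: power4_eq_xxxx power2_eq_square algebra_simps)
  also have "expectation \<dots> = 3 * (x + y + 2 * c)\<^sup>2 + 3 * (x + y - 2 * c)\<^sup>2 - 2 * (3 * x\<^sup>2) - 2 * (3 * y\<^sup>2)"
    using mplus(1)[of 4] mminus(1)[of 4] mX(1)[of 4] mY(1)[of 4]
    by (simp add: mplus(2) mminus(2) mX(2) mY(2) p2 m2 flip: x_def y_def)
  also have "\<dots> = 12 * (x * y + 2 * c\<^sup>2)" by (simp add: power2_eq_square algebra_simps)
  finally show "expectation (\<lambda>\<omega>. X \<omega> ^ 2 * Y \<omega> ^ 2) = x * y + 2 * c\<^sup>2" by simp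
qed

section \<open>Variance of sums of squares, and almost sure convergence from second moments\<close>

text \<open>The square expands into covariances of \<open>X i ^ 2\<close> and
  \<open>X j ^ 2\<close>, each equal to \<open>2 * (c i j)^2\<close> by Wick's formula. That formula
  is a hypothesis because the two kinds of increments obtain it differently: joint Gaussianity for
  the fractional part, independence for the Wiener part.\<close>

lemma (in prob_space) centered_square_sum_second_moment:
  fixes X :: "nat \<Rightarrow> 'a \<Rightarrow> real"
  assumes "\<And>i. i < n \<Longrightarrow> integrable M (\<lambda>\<omega>. X i \<omega> ^ 2)"
    and "\<And>i j. i < n \<Longrightarrow> j < n \<Longrightarrow> integrable M (\<lambda>\<omega>. X i \<omega> ^ 2 * X j \<omega> ^ 2)"
    and "\<And>i j. i < n \<Longrightarrow> j < n \<Longrightarrow> expectation (\<lambda>\<omega>. X i \<omega> ^ 2 * X j \<omega> ^ 2) =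
      expectation (\<lambda>\<omega>. X i \<omega> ^ 2) * expectation (\<lambda>\<omega>. X j \<omega> ^ 2) + 2 * (c i j)\<^sup>2"
    and "\<And>i. i < n \<Longrightarrow> expectation (\<lambda>\<omega>. X i \<omega> ^ 2) = v"
  shows "integrable M (\<lambda>\<omega>. ((\<Sum>i<n. X i \<omega> ^ 2) - real n * v) ^ 2)"
    and "expectation (\<lambda>\<omega>. ((\<Sum>i<n. X i \<omega> ^ 2) - real n * v) ^ 2) = 2 * (\<Sum>i<n. \<Sum>j<n. (c i j)\<^sup>2)"
proof -
  have *: "((\<Sum>i<n. X i \<omega> ^ 2) - real n * v) ^ 2 =
      (\<Sum>i<n. \<Sum>j<n. X i \<omega> ^ 2 * X j \<omega> ^ 2 - v * X i \<omega> ^ 2 - v * X j \<omega> ^ 2 + v * v)" for \<omega>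
  proof -
    have "((\<Sum>i<n. X i \<omega> ^ 2) - real n * v) ^ 2 = (\<Sum>i<n. X i \<omega> ^ 2 - v) * (\<Sum>j<n. X j \<omega> ^ 2 - v)"
      by (simp add: sum_subtractf power2_eq_square)
    also have "\<dots> = (\<Sum>i<n. \<Sum>j<n. (X i \<omega> ^ 2 - v) * (X j \<omega> ^ 2 - v))"
      by (rule sum_product)
    finally show ?thesis by (simp add: algebra_simps)
  qed
  have i: "integrable M (\<lambda>\<omega>. X i \<omega> ^ 2 * X j \<omega> ^ 2 - v * X i \<omega> ^ 2 - v * X j \<omega> ^ 2 + v * v)"
    if "i < n" "j < n" for i j
    using assms(1,2) that by (intro Bochner_Integration.integrable_add
      Bochner_Integration.integrable_diff integrable_mult_right) auto
  show "integrable M (\<lambda>\<omega>. ((\<Sum>i<n. X i \<omega> ^ 2) - real n * v) ^ 2)"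
    unfolding * using i by (intro Bochner_Integration.integrable_sum) auto
  have e: "expectation (\<lambda>\<omega>. X i \<omega> ^ 2 * X j \<omega> ^ 2 - v * X i \<omega> ^ 2 - v * X j \<omega> ^ 2 + v * v) = 2 * (c i j)\<^sup>2"
    if "i < n" "j < n" for i j
    using that assms(1)[of i] assms(1)[of j] assms(2)[of i j] prob_space by (simp add: assms(3,4))
  have "expectation (\<lambda>\<omega>. ((\<Sum>i<n. X i \<omega> ^ 2) - real n * v) ^ 2) = (\<Sum>i<n. \<Sum>j<n. 2 * (c i j)\<^sup>2)"
    unfolding * using i e
    by (subst Bochner_Integration.integral_sum)
      (auto intro!: Bochner_Integration.integrable_sum sum.cong simp: Bochner_Integration.integral_sum)
  then show "expectation (\<lambda>\<omega>. ((\<Sum>i<n. X i \<omega> ^ 2) - real n * v) ^ 2) = 2 * (\<Sum>i<n. \<Sum>j<n. (c i j)\<^sup>2)"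
    by (simp add: sum_distrib_left)
qed

text \<open>Expectation and sum may be interchanged for nonnegative terms, so the sum of all
  \<open>(k * X k)^2\<close> has finite expectation. It is then finite almost surely and its terms
  vanish in the limit. The weight \<open>k\<close> costs nothing against geometric decay.\<close>

lemma (in prob_space) AE_tendsto_zero_of_geometric_second_moment:
  fixes X :: "nat \<Rightarrow> 'a \<Rightarrow> real"
  assumes int: "\<And>k. integrable M (\<lambda>\<omega>. X k \<omega> ^ 2)"
    and bd: "\<And>k. expectation (\<lambda>\<omega>. X k \<omega> ^ 2) \<le> C * \<theta> ^ k"
    and \<theta>: "0 \<le> \<theta>" "\<theta> < 1"
  shows "AE \<omega> in M. (\<lambda>k. real k * X k \<omega>) \<longlonglongrightarrow> 0"
proof -
  have int': "integrable M (\<lambda>\<omega>. (real k * X k \<omega>) ^ 2)" for k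
    using int by (simp add: power_mult_distrib)
  have s: "summable (\<lambda>k. expectation (\<lambda>\<omega>. (real k * X k \<omega>) ^ 2))"
  proof (rule summable_comparison_test')
    have "summable (\<lambda>k. (real k) ^ 2 * \<theta> ^ k)"
    proof (rule summable_comparison_test_ev)
      \<comment> \<open>A slower geometric rate absorbs the factor \<open>k^2\<close>:
        \<open>k^2 * (\<theta> / \<rho>)^k\<close> is the square of a null sequence of the form
        \<open>k * x^k\<close> with \<open>x = sqrt (\<theta> / \<rho>) < 1\<close>.\<close>
      define \<rho> where "\<rho> = (1 + \<theta>) / 2"
      have \<rho>: "\<theta> < \<rho>" "\<rho> < 1" "0 < \<rho>" using \<theta> by (auto simp: \<rho>_def)
      show "summable (\<lambda>k. \<rho> ^ k)" using \<rho> by (intro summable_geometric) auto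
      have "(\<lambda>k. real k * sqrt (\<theta> / \<rho>) ^ k) \<longlonglongrightarrow> 0"
        using powser_times_n_limit_0[of "sqrt (\<theta> / \<rho>)"] \<theta> \<rho> by simp
      then have "(\<lambda>k. (real k * sqrt (\<theta> / \<rho>) ^ k) ^ 2) \<longlonglongrightarrow> 0 ^ 2"
        by (rule tendsto_power)
      moreover have "(real k * sqrt (\<theta> / \<rho>) ^ k) ^ 2 = (real k) ^ 2 * (\<theta> / \<rho>) ^ k" for k
        using \<theta> \<rho> by (simp add: power_mult_distrib flip: power_mult power_even_eq mult.commute)
          (simp add: power_mult mult.commute[of k])
      ultimately have "(\<lambda>k. (real k) ^ 2 * (\<theta> / \<rho>) ^ k) \<longlonglongrightarrow> 0" by simp
      then have "eventually (\<lambda>k. (real k) ^ 2 * (\<theta> / \<rho>) ^ k < 1) sequentially"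
        by (rule order_tendstoD) simp
      then show "eventually (\<lambda>k. norm ((real k) ^ 2 * \<theta> ^ k) \<le> \<rho> ^ k) sequentially"
        by eventually_elim (use \<theta> \<rho> in \<open>auto simp: power_divide field_simps abs_mult\<close>)
    qed
    then show "summable (\<lambda>k. C * ((real k) ^ 2 * \<theta> ^ k))" by (rule summable_mult)
    fix k :: nat
    show "norm (expectation (\<lambda>\<omega>. (real k * X k \<omega>) ^ 2)) \<le> C * ((real k) ^ 2 * \<theta> ^ k)"
      using mult_left_mono[OF bd[of k], of "(real k) ^ 2"]
      by (simp add: power_mult_distrib abs_mult algebra_simps)
  qed
  have "(\<integral>\<^sup>+\<omega>. (\<Sum>k. ennreal ((real k * X k \<omega>) ^ 2)) \<partial>M) = (\<Sum>k. \<integral>\<^sup>+\<omega>. ennreal ((real k * X k \<omega>) ^ 2) \<partial>M)"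
    using int' by (intro nn_integral_suminf) (auto dest!: borel_measurable_integrable)
  also have "\<dots> = (\<Sum>k. ennreal (expectation (\<lambda>\<omega>. (real k * X k \<omega>) ^ 2)))"
    by (intro suminf_cong nn_integral_eq_integral int') auto
  also have "\<dots> \<noteq> \<infinity>"
    using s by (simp add: ennreal_suminf_neq_top)
  finally have "AE \<omega> in M. (\<Sum>k. ennreal ((real k * X k \<omega>) ^ 2)) \<noteq> \<infinity>"
    using int' by (intro nn_integral_PInf_AE) (auto dest!: borel_measurable_integrable)
  then show ?thesis
  proof eventually_elim
    case (elim \<omega>)
    then have "summable (\<lambda>k. (real k * X k \<omega>) ^ 2)"
      by (intro summable_suminf_not_top) auto
    then have "(\<lambda>k. (real k * X k \<omega>) ^ 2) \<longlonglongrightarrow> 0" by (rule summable_LIMSEQ_zero)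
    then have "(\<lambda>k. sqrt ((real k * X k \<omega>) ^ 2)) \<longlonglongrightarrow> 0"
      using tendsto_real_sqrt by fastforce
    then show ?case by (simp add: tendsto_rabs_zero_iff del: abs_mult)
  qed
qed

section \<open>Covariances of fractional noise with exponent at most one\<close>

text \<open>Concavity of the power: after division by \<open>x\<close> the two points lie
  symmetrically about 1, where the tangent \<open>p * y + (1 - p)\<close> dominates
  \<open>y powr p\<close>, and the linear terms cancel in the sum. The tangent bound is weighted
  AM-GM for \<open>y\<close> and 1; \<open>y = 0\<close> occurs when \<open>h = x\<close>.\<close>

lemma powr_second_difference_le:
  fixes p x h :: real
  assumes p: "0 < p" "p \<le> 1" and "0 \<le> h" "h \<le> x" "0 < x"
  shows "(x + h) powr p + (x - h) powr p \<le> 2 * x powr p"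
proof -
  have bern: "y powr p \<le> p * y + (1 - p)" if "y \<ge> 0" for y
  proof (cases "y = 0")
    case False
    then show ?thesis using Youngs_inequality_0[of p "1 - p" y 1] p that by simp
  qed (use p in auto)
  have "(x + h) powr p + (x - h) powr p = x powr p * (((x + h) / x) powr p + ((x - h) / x) powr p)"
    using assms by (simp add: powr_divide distrib_left)
  also have "\<dots> \<le> x powr p * ((p * ((x + h) / x) + (1 - p)) + (p * ((x - h) / x) + (1 - p)))"
    using assms by (intro mult_left_mono add_mono bern) auto
  also have "\<dots> = 2 * x powr p"
    using assms by (simp add: field_simps)
  finally show ?thesis .
qed

text \<open>A nonnegative total forces the moduli of the nonpositive entries to add up to at most
  \<open>c i\<close>. Each modulus is then at most \<open>c i\<close> as well, so the squares of
  these entries add up to at most \<open>c i * c i\<close>.\<close>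

lemma sum_square_le_of_dominant_entry:
  fixes c :: "nat \<Rightarrow> real"
  assumes "i < n" and neg: "\<And>j. j < n \<Longrightarrow> j \<noteq> i \<Longrightarrow> c j \<le> 0" and nn: "(\<Sum>j<n. c j) \<ge> 0"
  shows "(\<Sum>j<n. (c j)\<^sup>2) \<le> 2 * (c i)\<^sup>2"
proof -
  let ?J = "{..<n} - {i}"
  have s: "(\<Sum>j\<in>?J. - c j) \<le> c i"
    using nn \<open>i < n\<close> by (subst (asm) sum.remove[of _ i]) (auto simp: sum_negf)
  have le: "- c j \<le> c i" if "j \<in> ?J" for j
    using member_le_sum[of j ?J "\<lambda>j. - c j"] neg that s by fastforce
  have "0 \<le> (\<Sum>j\<in>?J. - c j)" using neg by (intro sum_nonneg) auto
  with s have "0 \<le> c i" by linarith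
  have "(\<Sum>j\<in>?J. (c j)\<^sup>2) \<le> (\<Sum>j\<in>?J. c i * - c j)"
  proof (rule sum_mono)
    fix j assume "j \<in> ?J"
    then have "(- c j) * (- c j) \<le> c i * (- c j)"
      using neg le by (intro mult_right_mono) auto
    then show "(c j)\<^sup>2 \<le> c i * - c j" by (simp add: power2_eq_square)
  qed
  also have "\<dots> \<le> c i * c i"
    using s \<open>0 \<le> c i\<close> by (simp only: sum_distrib_left[symmetric] mult_left_mono)
  finally show ?thesis
    using \<open>i < n\<close> by (subst sum.remove[of _ i]) (auto simp: power2_eq_square)
qed

text \<open>For exponent \<open>2H \<le> 1\<close> distinct increments are negatively correlated, while every
  increment is nonnegatively correlated with the total increment, which telescopes.\<close>
lemma fractional_noise_covariance_row:
  fixes d p :: real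
  defines "c \<equiv> \<lambda>i j. (\<bar>d * real (Suc i) - d * real j\<bar> powr p + \<bar>d * real i - d * real (Suc j)\<bar> powr p
      - \<bar>d * real (Suc i) - d * real (Suc j)\<bar> powr p - \<bar>d * real i - d * real j\<bar> powr p) / 2"
  assumes d: "d > 0" and p: "0 < p" "p \<le> 1" and i: "i < n"
  shows "(\<Sum>j<n. (c i j)\<^sup>2) \<le> 2 * (d powr p)\<^sup>2"
proof -
  have "(\<Sum>j<n. (c i j)\<^sup>2) \<le> 2 * (c i i)\<^sup>2"
  proof (rule sum_square_le_of_dominant_entry[OF i])
    fix j assume "j \<noteq> i"
    define x where "x = \<bar>d * real i - d * real j\<bar>"
    have x: "d * 1 \<le> x"
    proof -
      have "1 \<le> \<bar>real i - real j\<bar>" using \<open>j \<noteq> i\<close> by linarith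
      then have "d * 1 \<le> d * \<bar>real i - real j\<bar>" using d by (intro mult_left_mono) auto
      also have "\<dots> = x" using d by (simp add: x_def abs_mult flip: right_diff_distrib)
      finally show ?thesis .
    qed
    have le: "(x + d) powr p + (x - d) powr p \<le> 2 * x powr p"
      using x d p by (intro powr_second_difference_le) auto
    \<comment> \<open>Twice the covariance is the second difference of the power at lag
      \<open>x\<close> with step \<open>d\<close>, up to the sign convention of \<open>c\<close>.
      The order of \<open>i\<close> and \<open>j\<close> only decides which of the two terms is the
      far one; for neighbours \<open>x = d\<close> and the near one is zero.\<close>
    have "\<bar>d * real (Suc i) - d * real j\<bar> powr p + \<bar>d * real i - d * real (Suc j)\<bar> powr p
        = (x + d) powr p + (x - d) powr p"
    proof (cases "d * real i \<le> d * real j")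
      case True
      then have "\<bar>d * real (Suc i) - d * real j\<bar> = x - d" "\<bar>d * real i - d * real (Suc j)\<bar> = x + d"
        using x d by (auto simp: x_def algebra_simps)
      then show ?thesis by simp
    next
      case False
      then have "\<bar>d * real (Suc i) - d * real j\<bar> = x + d" "\<bar>d * real i - d * real (Suc j)\<bar> = x - d"
        using x d by (auto simp: x_def algebra_simps)
      then show ?thesis by simp
    qed
    moreover have "\<bar>d * real (Suc i) - d * real (Suc j)\<bar> = x"
      by (simp add: x_def algebra_simps)
    ultimately show "c i j \<le> 0" using le by (simp add: c_def flip: x_def)
  next
    define f where "f j = \<bar>d * real i - d * real j\<bar> powr p - \<bar>d * real (Suc i) - d * real j\<bar> powr p" for j
    have "(\<Sum>j<n. c i j) = (\<Sum>j<n. f (Suc j) - f j) / 2"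
      by (simp add: c_def f_def sum_divide_distrib algebra_simps)
    also have "\<dots> = (f n - f 0) / 2" by (simp add: sum_lessThan_telescope)
    finally have sum: "(\<Sum>j<n. c i j) = (f n - f 0) / 2" .
    \<comment> \<open>Both \<open>f n\<close> and \<open>- f 0\<close> are nonnegative: the final
      time is at least as far from the left end of the interval as from its right end, and for time
      0 it is the other way round.\<close>
    have "f n - f 0 \<ge> 0"
    proof -
      have "d * real (Suc i) \<le> d * real n" using i d by (intro mult_left_mono) auto
      then have "\<bar>d * real (Suc i) - d * real n\<bar> powr p \<le> \<bar>d * real i - d * real n\<bar> powr p"
        using p d by (intro powr_mono2) (auto simp: algebra_simps)
      moreover have "\<bar>d * real i\<bar> powr p \<le> \<bar>d * real (Suc i)\<bar> powr p"
        using p d by (intro powr_mono2) (auto simp: algebra_simps abs_mult)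
      ultimately show ?thesis by (simp add: f_def)
    qed
    then show "0 \<le> (\<Sum>j<n. c i j)" by (simp add: sum)
  qed
  also have "c i i = d powr p" using d by (simp add: c_def algebra_simps)
  finally show ?thesis .
qed

section \<open>Increments and quadratic variation of fractional Brownian motion\<close>

lemma (in prob_space) gaussian_process_increment_pair:
  assumes "gaussian_process M I B" "s \<in> I" "t \<in> I" "u \<in> I" "v \<in> I"
  shows "gaussian_rv M (\<lambda>\<omega>. c * (B t \<omega> - B s \<omega>) + d * (B v \<omega> - B u \<omega>))"
proof -
  \<comment> \<open>The four times may coincide, and a set counts each only once; \<open>w r\<close>
    therefore adds up all coefficients that belong to the same time.\<close>
  define w where "w r = c * (of_bool (r = t) - of_bool (r = s)) + d * (of_bool (r = v) - of_bool (r = u))"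
    for r
  have "gaussian_rv M (\<lambda>\<omega>. \<Sum>r\<in>{s,t,u,v}. w r * B r \<omega>)"
    using assms unfolding gaussian_process_def by (metis empty_subsetI finite.emptyI finite.insertI insert_subset)
  moreover have "(\<Sum>r\<in>{s,t,u,v}. w r * B r \<omega>) = c * (B t \<omega> - B s \<omega>) + d * (B v \<omega> - B u \<omega>)" for \<omega>
  proof -
    have pick: "(\<Sum>r\<in>{s,t,u,v}. of_bool (r = z) * B r \<omega>) = B z \<omega>" if "z \<in> {s,t,u,v}" for z
    proof -
      have "(\<Sum>r\<in>{s,t,u,v}. of_bool (r = z) * B r \<omega>) = (\<Sum>r\<in>{s,t,u,v}. if r = z then B r \<omega> else 0)"
        by (intro sum.cong) auto
      also have "\<dots> = B z \<omega>" using that by (subst sum.delta) auto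
      finally show ?thesis .
    qed
    have "(\<Sum>r\<in>{s,t,u,v}. w r * B r \<omega>) = (\<Sum>r\<in>{s,t,u,v}. c * (of_bool (r = t) * B r \<omega>)
        - c * (of_bool (r = s) * B r \<omega>) + d * (of_bool (r = v) * B r \<omega>) - d * (of_bool (r = u) * B r \<omega>))"
      by (intro sum.cong) (auto simp: w_def algebra_simps)
    also have "\<dots> = c * B t \<omega> - c * B s \<omega> + d * B v \<omega> - d * B u \<omega>"
      unfolding sum.distrib sum_subtractf sum_distrib_left[symmetric]
      by (simp only: pick insertI1 insertI2)
    finally show ?thesis by (simp add: algebra_simps)
  qed
  ultimately show ?thesis by simp
qed

context prob_space
begin

lemma fbm_square_integrable:
  assumes "fractional_brownian_motion M I H B" "t \<in> I"
  shows "B t \<in> borel_measurable M" "integrable M (B t)" "integrable M (\<lambda>\<omega>. B t \<omega> ^ 2)"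
    "expectation (B t) = 0"
proof -
  show z: "expectation (B t) = 0"
    using assms unfolding fractional_brownian_motion_def by blast
  have "\<forall>J c. finite J \<longrightarrow> J \<subseteq> I \<longrightarrow> gaussian_rv M (\<lambda>\<omega>. \<Sum>t\<in>J. c t * B t \<omega>)"
    using assms unfolding fractional_brownian_motion_def gaussian_process_def by blast
  from this[rule_format, of "{t}" "\<lambda>_. 1"] have G: "gaussian_rv M (B t)" using assms(2) by simp
  then show "B t \<in> borel_measurable M" by (simp add: gaussian_rv_def)
  show "integrable M (B t)" "integrable M (\<lambda>\<omega>. B t \<omega> ^ 2)"
    using centered_gaussian_rv_moments(1)[OF G z, of 1] centered_gaussian_rv_moments(1)[OF G z, of 2]
    by simp_all
qed

text \<open>In the alternating sum of four covariances the powers of single times cancel and only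
  powers of lags remain. Every combination of the two increments is Gaussian, so Wick's formula
  gives the fourth order moment.\<close>

lemma fbm_increment_moments:
  assumes fbm: "fractional_brownian_motion M I H B" and I: "s \<in> I" "t \<in> I" "u \<in> I" "v \<in> I"
  defines "X \<equiv> \<lambda>\<omega>. B t \<omega> - B s \<omega>" and "Y \<equiv> \<lambda>\<omega>. B v \<omega> - B u \<omega>"
  shows "integrable M (\<lambda>\<omega>. X \<omega> * Y \<omega>)"
    and "expectation (\<lambda>\<omega>. X \<omega> * Y \<omega>) = (\<bar>t - u\<bar> powr (2 * H) + \<bar>s - v\<bar> powr (2 * H)
        - \<bar>t - v\<bar> powr (2 * H) - \<bar>s - u\<bar> powr (2 * H)) / 2"
    and "integrable M (\<lambda>\<omega>. X \<omega> ^ 2 * Y \<omega> ^ 2)"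
    and "expectation (\<lambda>\<omega>. X \<omega> ^ 2 * Y \<omega> ^ 2) =
      expectation (\<lambda>\<omega>. X \<omega> ^ 2) * expectation (\<lambda>\<omega>. Y \<omega> ^ 2) + 2 * (expectation (\<lambda>\<omega>. X \<omega> * Y \<omega>))\<^sup>2"
proof -
  note sq = fbm_square_integrable[OF fbm]
  have G: "gaussian_process M I B"
    and C: "\<And>t s. t \<in> I \<Longrightarrow> s \<in> I \<Longrightarrow> expectation (\<lambda>\<omega>. B t \<omega> * B s \<omega>) =
        (t powr (2 * H) + s powr (2 * H) - \<bar>t - s\<bar> powr (2 * H)) / 2"
    using fbm unfolding fractional_brownian_motion_def by blast+
  have ip: "integrable M (\<lambda>\<omega>. B t \<omega> * B s \<omega>)" if "t \<in> I" "s \<in> I" for s t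
    using that by (intro integrable_mult_square_integrable sq)
  have XY: "(\<lambda>\<omega>. X \<omega> * Y \<omega>) =
      (\<lambda>\<omega>. B t \<omega> * B v \<omega> - B t \<omega> * B u \<omega> - (B s \<omega> * B v \<omega> - B s \<omega> * B u \<omega>))"
    by (auto simp: X_def Y_def algebra_simps)
  show "integrable M (\<lambda>\<omega>. X \<omega> * Y \<omega>)" unfolding XY using I by (intro Bochner_Integration.integrable_diff ip)
  show "expectation (\<lambda>\<omega>. X \<omega> * Y \<omega>) = (\<bar>t - u\<bar> powr (2 * H) + \<bar>s - v\<bar> powr (2 * H)
        - \<bar>t - v\<bar> powr (2 * H) - \<bar>s - u\<bar> powr (2 * H)) / 2"
    unfolding XY using I by (simp add: ip C field_simps)
  have "expectation X = 0" "expectation Y = 0"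
    unfolding X_def Y_def using I by (simp_all add: sq)
  moreover have "gaussian_rv M (\<lambda>\<omega>. c * X \<omega> + d * Y \<omega>)" for c d
    unfolding X_def Y_def using G I by (rule gaussian_process_increment_pair)
  ultimately show "integrable M (\<lambda>\<omega>. X \<omega> ^ 2 * Y \<omega> ^ 2)"
    and "expectation (\<lambda>\<omega>. X \<omega> ^ 2 * Y \<omega> ^ 2) =
      expectation (\<lambda>\<omega>. X \<omega> ^ 2) * expectation (\<lambda>\<omega>. Y \<omega> ^ 2) + 2 * (expectation (\<lambda>\<omega>. X \<omega> * Y \<omega>))\<^sup>2"
    by (auto intro!: gaussian_pair_square_moment)
qed

text \<open>By Wick's formula the variance is twice the sum of all squared covariances. Since
  \<open>2 * H\<close> is at most 1, each of the \<open>n\<close> rows contributes at most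
  \<open>2 * v^2\<close>, so off-diagonal correlations cost only a constant factor.\<close>

lemma fbm_quadratic_variation_second_moment:
  assumes fbm: "fractional_brownian_motion M {0..T} H B" and "T > 0" "H \<le> 1/2" "n > 0"
  defines "v \<equiv> (T / real n) powr (2 * H)"
  shows "integrable M (\<lambda>\<omega>. (V_stat T (\<lambda>t. B t \<omega>) n - real n * v) ^ 2)"
    and "expectation (\<lambda>\<omega>. (V_stat T (\<lambda>t. B t \<omega>) n - real n * v) ^ 2) \<le> 4 * real n * v\<^sup>2"
proof -
  define d where "d = T / real n"
  have d: "d > 0" using assms by (simp add: d_def)
  have H: "0 < H" using fbm unfolding fractional_brownian_motion_def by blast
  have inc: "increment T x n i = x (d * real (Suc i)) - x (d * real i)" for x i
    by (simp add: increment_def d_def mult.commute)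
  have I: "d * real i \<in> {0..T}" if "i \<le> n" for i
    using that assms(2,4) by (auto simp: d_def field_simps)
  define X where "X i \<omega> = increment T (\<lambda>t. B t \<omega>) n i" for i \<omega>
  define c where "c i j = (\<bar>d * real (Suc i) - d * real j\<bar> powr (2*H) + \<bar>d * real i - d * real (Suc j)\<bar> powr (2*H)
      - \<bar>d * real (Suc i) - d * real (Suc j)\<bar> powr (2*H) - \<bar>d * real i - d * real j\<bar> powr (2*H)) / 2" for i j
  have c: "integrable M (\<lambda>\<omega>. X i \<omega> * X j \<omega>)" "expectation (\<lambda>\<omega>. X i \<omega> * X j \<omega>) = c i j"
      "integrable M (\<lambda>\<omega>. X i \<omega> ^ 2 * X j \<omega> ^ 2)"
      "expectation (\<lambda>\<omega>. X i \<omega> ^ 2 * X j \<omega> ^ 2) =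
        expectation (\<lambda>\<omega>. X i \<omega> ^ 2) * expectation (\<lambda>\<omega>. X j \<omega> ^ 2) + 2 * (c i j)\<^sup>2"
    if "i < n" "j < n" for i j
  proof -
    have "d * real i \<in> {0..T}" "d * real (Suc i) \<in> {0..T}" "d * real j \<in> {0..T}" "d * real (Suc j) \<in> {0..T}"
      using that by (auto intro!: I simp del: atLeastAtMost_iff of_nat_Suc)
    note m = fbm_increment_moments[OF fbm this]
    show "integrable M (\<lambda>\<omega>. X i \<omega> * X j \<omega>)" "expectation (\<lambda>\<omega>. X i \<omega> * X j \<omega>) = c i j"
      "integrable M (\<lambda>\<omega>. X i \<omega> ^ 2 * X j \<omega> ^ 2)"
      "expectation (\<lambda>\<omega>. X i \<omega> ^ 2 * X j \<omega> ^ 2) =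
        expectation (\<lambda>\<omega>. X i \<omega> ^ 2) * expectation (\<lambda>\<omega>. X j \<omega> ^ 2) + 2 * (c i j)\<^sup>2"
      by (simp_all only: X_def inc c_def m)
  qed
  have e: "expectation (\<lambda>\<omega>. X i \<omega> ^ 2) = v" if "i < n" for i
  proof -
    have "d * real (Suc i) - d * real i = d" by (simp add: algebra_simps)
    then show ?thesis
      using c(2)[OF that that] d
      by (simp add: c_def v_def power2_eq_square abs_minus_commute[of "d * real i"]
        flip: d_def del: of_nat_Suc)
  qed
  note m = centered_square_sum_second_moment[of n X c v]
  show "integrable M (\<lambda>\<omega>. (V_stat T (\<lambda>t. B t \<omega>) n - real n * v) ^ 2)"
    using m(1) c e by (simp add: V_stat_def X_def power2_eq_square)
  have "expectation (\<lambda>\<omega>. (V_stat T (\<lambda>t. B t \<omega>) n - real n * v) ^ 2) = 2 * (\<Sum>i<n. \<Sum>j<n. (c i j)\<^sup>2)"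
    using m(2) c e by (simp add: V_stat_def X_def power2_eq_square)
  also have "\<dots> \<le> 2 * (\<Sum>i<n. 2 * v\<^sup>2)"
    unfolding c_def v_def d_def[symmetric] using d H assms(3)
    by (intro mult_left_mono sum_mono fractional_noise_covariance_row) auto
  finally show "expectation (\<lambda>\<omega>. (V_stat T (\<lambda>t. B t \<omega>) n - real n * v) ^ 2) \<le> 4 * real n * v\<^sup>2"
    by simp
qed

section \<open>Increments and quadratic variation of the Wiener process\<close>

text \<open>Wick's formula again, now from independent increments: for distinct indices the moments
  factor and the correction term is zero, for equal indices it is the kurtosis
  \<open>3 = 1 + 2\<close>.\<close>

lemma wiener_increment_moments:
  assumes W: "wiener_process M {0..T} W" and T: "T > 0" and n: "n > 0"
  defines "Y \<equiv> \<lambda>i \<omega>. increment T (\<lambda>t. W t \<omega>) n i"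
  assumes ij: "i < n" "j < n"
  shows "integrable M (\<lambda>\<omega>. Y i \<omega> * Y j \<omega>)"
    and "expectation (\<lambda>\<omega>. Y i \<omega> * Y j \<omega>) = (if i = j then T / real n else 0)"
    and "integrable M (\<lambda>\<omega>. Y i \<omega> ^ 2 * Y j \<omega> ^ 2)"
    and "expectation (\<lambda>\<omega>. Y i \<omega> ^ 2 * Y j \<omega> ^ 2) =
      expectation (\<lambda>\<omega>. Y i \<omega> ^ 2) * expectation (\<lambda>\<omega>. Y j \<omega> ^ 2)
        + 2 * (if i = j then T / real n else 0)\<^sup>2"
proof -
  define d where "d = T / real n"
  have d: "d > 0" using T n by (simp add: d_def)
  have Y: "Y i = (\<lambda>\<omega>. W (d * real (Suc i)) \<omega> - W (d * real i) \<omega>)" for i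
    by (simp add: Y_def increment_def d_def mult.commute)
  have I: "d * real i \<in> {0..T}" if "i \<le> n" for i
    using that T n by (auto simp: d_def field_simps)
  have norm: "distributed M lborel (Y i) (normal_density 0 (sqrt d))" if "i < n" for i
  proof -
    have "d * real i < d * real (Suc i)" using d by simp
    moreover have "d * real i \<in> {0..T}" "d * real (Suc i) \<in> {0..T}" using that by (intro I; simp)+
    moreover have "d * real (Suc i) - d * real i = d" by (simp add: algebra_simps)
    ultimately show ?thesis using W unfolding wiener_process_def Y by metis
  qed
  have D: "integrable M (\<lambda>\<omega>. Y i \<omega> ^ k)" "expectation (Y i) = 0"
      "expectation (\<lambda>\<omega>. Y i \<omega> ^ 2) = d"
      "expectation (\<lambda>\<omega>. Y i \<omega> ^ 4) = 3 * (expectation (\<lambda>\<omega>. Y i \<omega> ^ 2))\<^sup>2" if "i < n" for i k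
  proof -
    have s: "sqrt d > 0" using d by simp
    show 0: "expectation (Y i) = 0" using normal_distributed_expectation[OF s norm[OF that]] .
    show "expectation (\<lambda>\<omega>. Y i \<omega> ^ 2) = d"
      using normal_distributed_variance[OF s norm[OF that]] 0 d by simp
    have "gaussian_rv M (Y i)"
      using norm[OF that] s unfolding gaussian_rv_def by (auto dest: distributed_measurable)
    from centered_gaussian_rv_moments[OF this 0]
    show "integrable M (\<lambda>\<omega>. Y i \<omega> ^ k)"
      "expectation (\<lambda>\<omega>. Y i \<omega> ^ 4) = 3 * (expectation (\<lambda>\<omega>. Y i \<omega> ^ 2))\<^sup>2" by simp_all
  qed
  have ind: "indep_vars (\<lambda>_. borel) Y {..<n}"
  proof -
    note iv = W[unfolded wiener_process_def, THEN conjunct2, THEN conjunct2, THEN conjunct1, rule_format]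
    have "indep_vars (\<lambda>_. borel) (\<lambda>i \<omega>. W (d * real (Suc i)) \<omega> - W (d * real i) \<omega>) {..<n}"
      by (rule iv[where t = "\<lambda>i. d * real i"]) (use I d in \<open>auto simp del: atLeastAtMost_iff\<close>)
    then show ?thesis unfolding Y[abs_def] .
  qed
  \<comment> \<open>The exponent \<open>m = 1\<close> serves the covariance and \<open>m = 2\<close>
    the moment of squares.\<close>
  have prod: "integrable M (\<lambda>\<omega>. Y i \<omega> ^ m * Y j \<omega> ^ m)"
      "expectation (\<lambda>\<omega>. Y i \<omega> ^ m * Y j \<omega> ^ m) =
        expectation (\<lambda>\<omega>. Y i \<omega> ^ m) * expectation (\<lambda>\<omega>. Y j \<omega> ^ m)" if "i \<noteq> j" for m
  proof -
    have "indep_vars (\<lambda>_. borel) Y {i, j}"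
      by (rule indep_vars_subset[OF ind]) (use ij in auto)
    then have *: "indep_vars (\<lambda>_. borel) (\<lambda>i \<omega>. Y i \<omega> ^ m) {i, j}"
      by (rule indep_vars_compose2) auto
    from indep_vars_integrable[OF _ *] indep_vars_lebesgue_integral[OF _ *]
    show "integrable M (\<lambda>\<omega>. Y i \<omega> ^ m * Y j \<omega> ^ m)"
      "expectation (\<lambda>\<omega>. Y i \<omega> ^ m * Y j \<omega> ^ m) =
        expectation (\<lambda>\<omega>. Y i \<omega> ^ m) * expectation (\<lambda>\<omega>. Y j \<omega> ^ m)"
      using that D(1)[OF ij(1)] D(1)[OF ij(2)] by auto
  qed
  have pow: "y ^ 2 * y ^ 2 = y ^ 4" for y :: real
    by (simp flip: power_add)
  show "integrable M (\<lambda>\<omega>. Y i \<omega> * Y j \<omega>)"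
    using prod(1)[of 1] D(1)[OF ij(1), of 2] by (cases "i = j") (simp_all add: power2_eq_square)
  show "expectation (\<lambda>\<omega>. Y i \<omega> * Y j \<omega>) = (if i = j then T / real n else 0)"
    using prod(2)[of 1] D(2,3) ij by (cases "i = j") (simp_all add: power2_eq_square flip: d_def)
  show "integrable M (\<lambda>\<omega>. Y i \<omega> ^ 2 * Y j \<omega> ^ 2)"
    using prod(1)[of 2] D(1)[OF ij(1), of 4] by (cases "i = j") (simp_all add: pow)
  show "expectation (\<lambda>\<omega>. Y i \<omega> ^ 2 * Y j \<omega> ^ 2) =
      expectation (\<lambda>\<omega>. Y i \<omega> ^ 2) * expectation (\<lambda>\<omega>. Y j \<omega> ^ 2)
        + 2 * (if i = j then T / real n else 0)\<^sup>2"
  proof (cases "i = j")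
    case True
    then show ?thesis using D(3,4)[OF ij(1)] by (simp add: pow flip: d_def) (simp add: power2_eq_square)
  next
    case False
    then show ?thesis using prod(2)[of 2] by simp
  qed
qed

lemma wiener_quadratic_variation_second_moment:
  assumes W: "wiener_process M {0..T} W" and T: "T > 0" and n: "n > 0"
  shows "integrable M (\<lambda>\<omega>. (V_stat T (\<lambda>t. W t \<omega>) n - T) ^ 2)"
    and "expectation (\<lambda>\<omega>. (V_stat T (\<lambda>t. W t \<omega>) n - T) ^ 2) = 2 * T\<^sup>2 / real n"
proof -
  define Y where "Y i \<omega> = increment T (\<lambda>t. W t \<omega>) n i" for i \<omega>
  define c where "c i j = (if i = j then T / real n else 0)" for i j :: nat
  note w = wiener_increment_moments[OF assms, folded Y_def c_def]
  have e: "expectation (\<lambda>\<omega>. Y i \<omega> ^ 2) = T / real n" if "i < n" for i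
    using w(2)[OF that that] by (simp add: power2_eq_square c_def)
  have i: "integrable M (\<lambda>\<omega>. Y i \<omega> ^ 2)" if "i < n" for i
    using w(1)[OF that that] by (simp add: power2_eq_square)
  note m = centered_square_sum_second_moment[of n Y c "T / real n", OF i w(3) w(4) e]
  have V: "V_stat T (\<lambda>t. W t \<omega>) n - T = (\<Sum>i<n. Y i \<omega> ^ 2) - real n * (T / real n)" for \<omega>
    using n by (simp add: V_stat_def Y_def)
  show "integrable M (\<lambda>\<omega>. (V_stat T (\<lambda>t. W t \<omega>) n - T) ^ 2)"
    unfolding V by (rule m(1))
  have "expectation (\<lambda>\<omega>. (V_stat T (\<lambda>t. W t \<omega>) n - T) ^ 2) = 2 * (\<Sum>i<n. \<Sum>j<n. (c i j)\<^sup>2)"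
    unfolding V by (rule m(2))
  also have "(\<Sum>i<n. \<Sum>j<n. (c i j)\<^sup>2) = (\<Sum>i<n. (T / real n)\<^sup>2)"
    by (intro sum.cong refl) (simp add: c_def if_distrib[of "\<lambda>x. x\<^sup>2"] cong: if_cong)
  finally show "expectation (\<lambda>\<omega>. (V_stat T (\<lambda>t. W t \<omega>) n - T) ^ 2) = 2 * T\<^sup>2 / real n"
    using n by (simp add: power2_eq_square)
qed

section \<open>The cross variation\<close>

text \<open>Independence of the processes splits each term of the expanded square into a fractional
  covariance times a Wiener covariance. The latter vanishes off the diagonal, which leaves
  \<open>n\<close> terms \<open>(T / n) powr (2 * H) * (T / n)\<close>.\<close>

lemma cross_variation_second_moment:
  assumes fbm: "fractional_brownian_motion M {0..T} H B" and W: "wiener_process M {0..T} W"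
    and ind: "independent_processes M {0..T} B W" and T: "T > 0" and n: "n > 0"
  defines "R \<equiv> \<lambda>\<omega>. \<Sum>i<n. increment T (\<lambda>t. B t \<omega>) n i * increment T (\<lambda>t. W t \<omega>) n i"
  shows "integrable M (\<lambda>\<omega>. R \<omega> ^ 2)"
    and "expectation (\<lambda>\<omega>. R \<omega> ^ 2) = T * (T / real n) powr (2 * H)"
proof -
  define d where "d = T / real n"
  have d: "d > 0" using T n by (simp add: d_def)
  have inc: "increment T x n i = x (d * real (Suc i)) - x (d * real i)" for x i
    by (simp add: increment_def d_def mult.commute)
  have I: "d * real i \<in> {0..T}" if "i \<le> n" for i
    using that T n by (auto simp: d_def field_simps)
  define X where "X i \<omega> = increment T (\<lambda>t. B t \<omega>) n i" for i \<omega>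
  define Y where "Y i \<omega> = increment T (\<lambda>t. W t \<omega>) n i" for i \<omega>
  define c where "c i j = (if i = j then T / real n else 0)" for i j :: nat
  note w = wiener_increment_moments[OF W T n, folded Y_def c_def]
  have x: "integrable M (\<lambda>\<omega>. X i \<omega> * X j \<omega>)" "expectation (\<lambda>\<omega>. X i \<omega> ^ 2) = d powr (2 * H)"
    if "i < n" "j < n" for i j
  proof -
    have J: "d * real i \<in> {0..T}" "d * real (Suc i) \<in> {0..T}" "d * real j \<in> {0..T}" "d * real (Suc j) \<in> {0..T}"
      using that by (auto intro!: I simp del: atLeastAtMost_iff of_nat_Suc)
    show "integrable M (\<lambda>\<omega>. X i \<omega> * X j \<omega>)"
      using fbm_increment_moments(1)[OF fbm J] by (simp only: X_def inc)
    have "d * real (Suc i) - d * real i = d" by (simp add: algebra_simps)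
    then show "expectation (\<lambda>\<omega>. X i \<omega> ^ 2) = d powr (2 * H)"
      using fbm_increment_moments(2)[OF fbm J(1,2) J(1,2)] d
      by (simp add: X_def inc power2_eq_square abs_minus_commute[of "d * real i"] del: of_nat_Suc)
  qed
  have prod: "integrable M (\<lambda>\<omega>. (X i \<omega> * X j \<omega>) * (Y i \<omega> * Y j \<omega>))"
      "expectation (\<lambda>\<omega>. (X i \<omega> * X j \<omega>) * (Y i \<omega> * Y j \<omega>)) =
        expectation (\<lambda>\<omega>. X i \<omega> * X j \<omega>) * c i j" if "i < n" "j < n" for i j
  proof -
    have J: "d * real i \<in> {0..T}" "d * real (Suc i) \<in> {0..T}" "d * real j \<in> {0..T}" "d * real (Suc j) \<in> {0..T}"
      using that by (auto intro!: I simp del: atLeastAtMost_iff of_nat_Suc)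
    \<comment> \<open>Independence is given for whole paths restricted to \<open>{0..T}\<close>. The
      functional \<open>g\<close> reads a path at grid times in this set only, so it is measurable
      on the product space and insensitive to the restriction.\<close>
    define g where "g f = increment T f n i * increment T f n j" for f
    have g: "g \<in> borel_measurable (PiM {0..T} (\<lambda>_. borel))"
      unfolding g_def inc using J by measurable
    have r: "g (\<lambda>t\<in>{0..T}. f t) = g f" for f
      using J by (simp only: g_def inc restrict_apply' J)
    have "indep_var borel (g \<circ> (\<lambda>\<omega>. \<lambda>t\<in>{0..T}. B t \<omega>)) borel (g \<circ> (\<lambda>\<omega>. \<lambda>t\<in>{0..T}. W t \<omega>))"
      using ind unfolding independent_processes_def by (rule indep_var_compose) (rule g)+
    then have "indep_var borel (\<lambda>\<omega>. X i \<omega> * X j \<omega>) borel (\<lambda>\<omega>. Y i \<omega> * Y j \<omega>)"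
      by (simp add: comp_def r) (simp add: g_def X_def Y_def)
    from indep_var_integrable[OF this] indep_var_lebesgue_integral[OF this]
    show "integrable M (\<lambda>\<omega>. (X i \<omega> * X j \<omega>) * (Y i \<omega> * Y j \<omega>))"
      "expectation (\<lambda>\<omega>. (X i \<omega> * X j \<omega>) * (Y i \<omega> * Y j \<omega>)) =
        expectation (\<lambda>\<omega>. X i \<omega> * X j \<omega>) * c i j"
      using x(1)[OF that] w(1,2)[OF that] by simp_all
  qed
  have R: "R \<omega> ^ 2 = (\<Sum>i<n. \<Sum>j<n. (X i \<omega> * X j \<omega>) * (Y i \<omega> * Y j \<omega>))" for \<omega>
    unfolding R_def power2_eq_square X_def[symmetric] Y_def[symmetric] sum_product
    by (simp add: mult_ac)
  show "integrable M (\<lambda>\<omega>. R \<omega> ^ 2)"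
    unfolding R using prod(1) by (intro Bochner_Integration.integrable_sum) auto
  have "expectation (\<lambda>\<omega>. R \<omega> ^ 2) = (\<Sum>i<n. \<Sum>j<n. expectation (\<lambda>\<omega>. X i \<omega> * X j \<omega>) * c i j)"
    unfolding R using prod
    by (subst Bochner_Integration.integral_sum)
      (auto intro!: Bochner_Integration.integrable_sum sum.cong simp: Bochner_Integration.integral_sum)
  also have "\<dots> = (\<Sum>i<n. d powr (2 * H) * (T / real n))"
  proof (intro sum.cong refl)
    fix i assume "i \<in> {..<n}"
    then show "(\<Sum>j<n. expectation (\<lambda>\<omega>. X i \<omega> * X j \<omega>) * c i j) = d powr (2 * H) * (T / real n)"
      using x(2)[of i i]
      by (simp add: c_def power2_eq_square if_distrib[of "\<lambda>x. _ * x"] cong: if_cong)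
  qed
  also have "\<dots> = T * (T / real n) powr (2 * H)" using n by (simp add: d_def)
  finally show "expectation (\<lambda>\<omega>. R \<omega> ^ 2) = T * (T / real n) powr (2 * H)" .
qed

end

section \<open>Limits of the estimators along a fixed path\<close>

text \<open>A relative error that is \<open>o(1/k)\<close> stays so under the logarithm, since
  \<open>\<bar>ln (1 + r)\<bar>\<close> is at most \<open>2 * \<bar>r\<bar>\<close> once
  \<open>\<bar>r\<bar>\<close> is at most 1/2.\<close>

lemma tendsto_linear_ln_one_plus:
  fixes r :: "nat \<Rightarrow> real"
  assumes "(\<lambda>k. real k * r k) \<longlonglongrightarrow> 0"
  shows "(\<lambda>k. real k * ln (1 + r k)) \<longlonglongrightarrow> 0"
proof (rule Lim_null_comparison)
  have "(\<lambda>k. \<bar>real k * r k\<bar>) \<longlonglongrightarrow> 0" using assms by (rule tendsto_rabs_zero)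
  then show "(\<lambda>k. 2 * \<bar>real k * r k\<bar>) \<longlonglongrightarrow> 0" by (rule tendsto_mult_right_zero)
  have "eventually (\<lambda>k. \<bar>real k * r k\<bar> < 1 / 2) sequentially"
    using \<open>(\<lambda>k. \<bar>real k * r k\<bar>) \<longlonglongrightarrow> 0\<close> by (rule order_tendstoD) simp
  then show "eventually (\<lambda>k. norm (real k * ln (1 + r k)) \<le> 2 * \<bar>real k * r k\<bar>) sequentially"
    using eventually_gt_at_top[of 0]
  proof eventually_elim
    case (elim k)
    have "1 * \<bar>r k\<bar> \<le> real k * \<bar>r k\<bar>" using elim by (intro mult_right_mono) auto
    then have r: "\<bar>r k\<bar> \<le> 1 / 2" using elim by (simp add: abs_mult)
    have "\<bar>ln (1 + r k) - r k\<bar> \<le> 2 * (r k)\<^sup>2" by (rule abs_ln_one_plus_x_minus_x_bound[OF r])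
    also have "\<dots> = 2 * \<bar>r k\<bar> * \<bar>r k\<bar>" by (simp add: power2_eq_square)
    also have "\<dots> \<le> 1 * \<bar>r k\<bar>" using r by (intro mult_right_mono) auto
    finally have "\<bar>ln (1 + r k)\<bar> \<le> 2 * \<bar>r k\<bar>" by linarith
    then have "real k * \<bar>ln (1 + r k)\<bar> \<le> real k * (2 * \<bar>r k\<bar>)" by (intro mult_left_mono) auto
    then show ?case by (simp add: abs_mult mult.left_commute)
  qed
qed

lemma tendsto_of_linear_tendsto:
  fixes r :: "nat \<Rightarrow> real"
  assumes "(\<lambda>k. real k * r k) \<longlonglongrightarrow> 0"
  shows "r \<longlonglongrightarrow> 0"
proof (rule Lim_null_comparison)
  show "(\<lambda>k. \<bar>real k * r k\<bar>) \<longlonglongrightarrow> 0" using assms by (rule tendsto_rabs_zero)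
  show "eventually (\<lambda>k. norm (r k) \<le> \<bar>real k * r k\<bar>) sequentially"
    using eventually_gt_at_top[of 0]
  proof eventually_elim
    case (elim k)
    have "1 * \<bar>r k\<bar> \<le> real k * \<bar>r k\<bar>" using elim by (intro mult_right_mono) auto
    then show ?case by (simp add: abs_mult)
  qed
qed

text \<open>Write \<open>V = \<alpha> * q^k * (1 + r k)\<close> and take logarithms. The exponent
  estimate contributes \<open>- k * ln q\<close> and \<open>V\<close> contributes
  \<open>k * ln q\<close>; these cancel, and what is left of the factor \<open>k\<close> multiplies
  only differences of \<open>ln (1 + r k)\<close>.\<close>

lemma a_sq_est_tendsto:
  assumes "T > 0" "\<alpha> > 0" "q > 1"
    and V: "\<And>k. V_stat T x (2 ^ k) = \<alpha> * q ^ k + \<beta> + e k"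
    and e: "(\<lambda>k. real k * (e k / q ^ k)) \<longlonglongrightarrow> 0"
  shows "(\<lambda>k. a_sq_est T x k) \<longlonglongrightarrow> \<alpha> * T powr (log 2 q - 1)"
proof -
  define r where "r k = (\<beta> + e k) / (\<alpha> * q ^ k)" for k
  have "(\<lambda>k. real k * (1 / q) ^ k) \<longlonglongrightarrow> 0"
    using powser_times_n_limit_0[of "1 / q"] assms(3) by simp
  \<comment> \<open>The constant \<open>\<beta>\<close> counts as part of the error here: relative
    to \<open>q^k\<close> it decays geometrically.\<close>
  from tendsto_add[OF tendsto_mult[OF tendsto_const[of "\<beta> / \<alpha>"] this]
      tendsto_mult[OF tendsto_const[of "1 / \<alpha>"] e]]
  have kr: "(\<lambda>k. real k * r k) \<longlonglongrightarrow> 0"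
    using assms(2,3) by (simp add: r_def field_simps power_divide)
  define l where "l k = ln (1 + r k)" for k
  have kl: "(\<lambda>k. real k * l k) \<longlonglongrightarrow> 0"
    unfolding l_def by (rule tendsto_linear_ln_one_plus[OF kr])
  then have l: "l \<longlonglongrightarrow> 0" by (rule tendsto_of_linear_tendsto)
  from l have l': "(\<lambda>k. l (Suc k)) \<longlonglongrightarrow> 0" by (rule LIMSEQ_Suc)
  \<comment> \<open>The shifted limit carries the factor \<open>k + 1\<close>; subtracting one copy
    of \<open>l (Suc k)\<close> restores \<open>k\<close>.\<close>
  from tendsto_diff[OF LIMSEQ_Suc[OF kl] l'] have kl': "(\<lambda>k. real k * l (Suc k)) \<longlonglongrightarrow> 0"
    by (simp add: algebra_simps)
  \<comment> \<open>This is the logarithm of the estimator after the cancellation of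
    \<open>k * ln q\<close>.\<close>
  define g where "g k = real k * l k - real k * l (Suc k) -
      ((l k - l (Suc k) - ln q) / ln 2 + 1) * ln T + ln \<alpha> + l k" for k
  have "g \<longlonglongrightarrow> 0 - 0 - ((0 - 0 - ln q) / ln 2 + 1) * ln T + ln \<alpha> + 0"
    unfolding g_def by (intro tendsto_intros kl kl' l l') auto
  then have "(\<lambda>k. exp (g k)) \<longlonglongrightarrow> exp (ln \<alpha> + (ln q / ln 2 - 1) * ln T)"
    by (intro tendsto_exp) (simp add: algebra_simps)
  also have "exp (ln \<alpha> + (ln q / ln 2 - 1) * ln T) = \<alpha> * T powr (log 2 q - 1)"
    using assms(1,2) by (simp add: exp_add powr_def log_def)
  finally have lim: "(\<lambda>k. exp (g k)) \<longlonglongrightarrow> \<alpha> * T powr (log 2 q - 1)" .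
  have "r \<longlonglongrightarrow> 0" using kr by (rule tendsto_of_linear_tendsto)
  then have "eventually (\<lambda>k. r k > -1) sequentially" by (rule order_tendstoD) simp
  \<comment> \<open>Both values of \<open>V\<close> must be positive for the logarithms to be
    genuine, which holds only from some \<open>k\<close> on.\<close>
  then have "eventually (\<lambda>k. r k > -1 \<and> r (Suc k) > -1) sequentially"
    by (intro eventually_conj) (simp_all only: eventually_sequentially_Suc[of "\<lambda>k. r k > -1"])
  then have "eventually (\<lambda>k. exp (g k) = a_sq_est T x k) sequentially"
  proof eventually_elim
    case (elim k)
    have q: "q > 0" using assms(3) by simp
    have v: "V_stat T x (2 ^ k) = exp (ln \<alpha> + real k * ln q + l k)" if "r k > -1" for k
    proof -
      have "V_stat T x (2 ^ k) = \<alpha> * q ^ k * (1 + r k)"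
        using assms(2) q by (simp add: V r_def field_simps)
      then show ?thesis using assms(2) q that
        by (simp add: l_def exp_add exp_of_nat_mult)
    qed
    define y where "y = l k - l (Suc k) - ln q"
    have "V_stat T x (2 ^ k) / V_stat T x (2 ^ (k + 1)) = exp y"
      using elim by (simp only: Suc_eq_plus1[symmetric] v)
        (simp add: y_def algebra_simps flip: exp_diff)
    then have H: "2 * H_est T x k = y / ln 2 + 1"
      by (simp add: H_est_def log_def)
    have "a_sq_est T x k = exp (real k * y) * exp (- (y / ln 2 + 1) * ln T)
        * exp (ln \<alpha> + real k * ln q + l k)"
      unfolding a_sq_est_def mult_minus_left H using elim assms(1) by (simp add: v powr_def algebra_simps)
    also have "\<dots> = exp (g k)"
      by (simp add: g_def y_def algebra_simps flip: exp_add)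
    finally show ?case by simp
  qed
  with lim show ?thesis by (rule Lim_transform_eventually)
qed

text \<open>The estimated growth factor \<open>z k\<close> replaces \<open>q\<close> in
  \<open>q * V k - V (k + 1)\<close>, which would remove the growing term exactly. Its error is
  multiplied by \<open>q^k\<close>, but \<open>z k - q\<close> is a combination of the
  \<open>e\<close> divided by \<open>U\<close>, and \<open>U\<close> itself grows like
  \<open>q^k\<close>; hence \<open>e\<close> tending to zero suffices.\<close>

lemma b_sq_est_tendsto:
  assumes "T > 0" "\<alpha> > 0" "q > 1"
    and V: "\<And>k. V_stat T x (2 ^ k) = \<alpha> * q ^ k + \<beta> + e k"
    and e: "e \<longlonglongrightarrow> 0"
  shows "(\<lambda>k. b_sq_est T x k) \<longlonglongrightarrow> \<beta> / T"
proof -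
  have q0: "q > 0" using assms(3) by simp
  define u where "u k = U_stat T x k / q ^ k" for k
  have e': "(\<lambda>k. e (Suc k)) \<longlonglongrightarrow> 0" "(\<lambda>k. e (Suc (Suc k))) \<longlonglongrightarrow> 0"
    using LIMSEQ_Suc[OF e] LIMSEQ_Suc[OF LIMSEQ_Suc[OF e]] by simp_all
  have U: "U_stat T x k = \<alpha> * (1 - q) * q ^ k + (e k - e (Suc k))" for k
    using V[of k] V[of "Suc k"] by (simp add: U_stat_def algebra_simps)
  have qk: "(\<lambda>k. (1 / q) ^ k) \<longlonglongrightarrow> 0"
    using assms(3) by (intro LIMSEQ_realpow_zero) auto
  have "(\<lambda>k. \<alpha> * (1 - q) + (e k - e (Suc k)) * (1 / q) ^ k) \<longlonglongrightarrow> \<alpha> * (1 - q) + (0 - 0) * 0"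
    by (intro tendsto_intros e e' qk)
  moreover have "u k = \<alpha> * (1 - q) + (e k - e (Suc k)) * (1 / q) ^ k" for k
    using q0 by (simp add: u_def U power_divide field_simps)
  ultimately have "(\<lambda>k. u k) \<longlonglongrightarrow> \<alpha> * (1 - q)" by simp
  then have u: "u \<longlonglongrightarrow> \<alpha> * (1 - q)" .
  then have u': "(\<lambda>k. u (Suc k)) \<longlonglongrightarrow> \<alpha> * (1 - q)" by (rule LIMSEQ_Suc)
  have neg: "\<alpha> * (1 - q) < 0" using assms by (simp add: mult_pos_neg)
  \<comment> \<open>The reciprocal of the ratio inside \<open>H2_est\<close>, because
    \<open>1 - 2 * H2_est\<close> is minus its logarithm; \<open>z k\<close> will be
    \<open>2 powr (1 - 2 * H2_est T x k)\<close>.\<close>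
  define z where "z k = U_stat T x (Suc k) / U_stat T x k" for k
  have zu: "z k = q * (u (Suc k) / u k)" for k
    using q0 by (simp add: z_def u_def)
  have "(\<lambda>k. q * (u (Suc k) / u k)) \<longlonglongrightarrow> q * (\<alpha> * (1 - q) / (\<alpha> * (1 - q)))"
    using neg by (intro tendsto_intros u u') auto
  then have "(\<lambda>k. z k) \<longlonglongrightarrow> q" using assms(2,3) by (simp add: zu)
  then have z: "z \<longlonglongrightarrow> q" .
  \<comment> \<open>The numerator of the estimator, with \<open>q^k * (z k - q)\<close> already
    rewritten through the normalised \<open>u k\<close>, whose limit is nonzero.\<close>
  define f where "f k = \<beta> * (z k - 1)
      + \<alpha> * (((e (Suc k) - e (Suc (Suc k))) - q * (e k - e (Suc k))) / u k)
      + z k * e k - e (Suc k)" for k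
  have "(\<lambda>k. f k / ((z k - 1) * T)) \<longlonglongrightarrow> (\<beta> * (q - 1)
      + \<alpha> * (((0 - 0) - q * (0 - 0)) / (\<alpha> * (1 - q))) + q * 0 - 0) / ((q - 1) * T)"
    unfolding f_def using neg assms by (intro tendsto_intros z u e e') auto
  then have lim: "(\<lambda>k. f k / ((z k - 1) * T)) \<longlonglongrightarrow> \<beta> / T"
    using assms(1,3) by simp
  \<comment> \<open>Since \<open>q > 1\<close>, the differences \<open>U\<close> are eventually
    negative. Their ratio is then positive, so \<open>log2_plus\<close> is the true logarithm and
    not its default 0.\<close>
  have "eventually (\<lambda>k. u k < 0) sequentially"
    using u neg by (rule order_tendstoD)
  then have "eventually (\<lambda>k. u k < 0 \<and> u (Suc k) < 0) sequentially"
    by (intro eventually_conj) (simp_all only: eventually_sequentially_Suc[of "\<lambda>k. u k < 0"])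
  then have "eventually (\<lambda>k. f k / ((z k - 1) * T) = b_sq_est T x k) sequentially"
  proof eventually_elim
    case (elim k)
    have neg: "U_stat T x k < 0" "U_stat T x (Suc k) < 0"
      using elim zero_less_power[OF q0, of k] zero_less_power[OF q0, of "Suc k"] q0
      by (auto simp: u_def divide_less_0_iff simp del: power_Suc)
    have "1 - 2 * H2_est T x k = - log 2 (U_stat T x k / U_stat T x (Suc k))"
      using neg by (simp add: H2_est_def log2_plus_def zero_less_divide_iff add_divide_distrib)
    then have "2 powr (1 - 2 * H2_est T x k) = z k"
      using neg by (simp add: z_def powr_minus zero_less_divide_iff)
    moreover have "z k * V_stat T x (2 ^ k) - V_stat T x (2 ^ (k + 1)) = f k"
    proof -
      \<comment> \<open>The leading geometric terms cancel in
        \<open>U (k + 1) - q * U k\<close>.\<close>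
      have "z k - q = ((e (Suc k) - e (Suc (Suc k))) - q * (e k - e (Suc k))) / U_stat T x k"
        using neg by (simp add: z_def divide_simps) (simp add: U algebra_simps)
      then have *: "\<alpha> * q ^ k * (z k - q) =
          \<alpha> * (((e (Suc k) - e (Suc (Suc k))) - q * (e k - e (Suc k))) / u k)"
        using q0 by (simp add: u_def)
      have "z k * V_stat T x (2 ^ k) - V_stat T x (2 ^ (k + 1)) =
          \<beta> * (z k - 1) + \<alpha> * q ^ k * (z k - q) + z k * e k - e (Suc k)"
        using V[of k] V[of "Suc k"] by (simp add: algebra_simps)
      then show ?thesis by (simp only: * f_def)
    qed
    ultimately show ?case by (simp add: b_sq_est_def)
  qed
  with lim show ?thesis by (rule Lim_transform_eventually)
qed

section \<open>Decomposition of the mixed quadratic variation and conclusion\<close>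

theorem proposition3p2:
  fixes M :: "'a measure" and B W :: "real \<Rightarrow> 'a \<Rightarrow> real" and T a b H :: real
  assumes "prob_space M"
    and "T > 0" and "a > 0" and "b > 0"
    and "fractional_brownian_motion M {0..T} H B"
    and "wiener_process M {0..T} W"
    and "independent_processes M {0..T} B W"
  shows "(H \<in> {0<..<1/2} \<longrightarrow>
            (AE \<omega> in M. (\<lambda>k. a_sq_est T (mixed_path a b B W \<omega>) k) \<longlonglongrightarrow> a\<^sup>2)) \<and>
         (H \<in> {1/4<..<1/2} \<longrightarrow>
            (AE \<omega> in M. (\<lambda>k. b_sq_est T (mixed_path a b B W \<omega>) k) \<longlonglongrightarrow> b\<^sup>2))"
proof -
  interpret prob_space M by fact
  \<comment> \<open>Halving the mesh multiplies the variance of a fractional increment by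
    \<open>s\<close> and doubles the number of increments, so their total variance
    \<open>\<tau> * q^k\<close> grows by \<open>q = 2 * s\<close>.\<close>
  define s where "s = 2 powr (- (2 * H))"
  define q where "q = 2 powr (1 - 2 * H)"
  define \<tau> where "\<tau> = T powr (2 * H)"
  have qs: "q = 2 * s" by (simp add: q_def s_def powr_diff powr_minus divide_simps)
  have s: "s > 0" and \<tau>: "\<tau> > 0" using assms(2) by (simp_all add: s_def \<tau>_def)
  have scale: "(T / real (2 ^ k)) powr (2 * H) = \<tau> * s ^ k" for k
  proof -
    have "real (2 ^ k) powr (2 * H) = (2 powr (2 * H)) ^ k"
      by (simp add: powr_powr flip: powr_realpow) (simp add: mult.commute)
    then show ?thesis
      using powr_divide[of T "real (2 ^ k)" "2 * H"] assms(2)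
      by (simp add: \<tau>_def s_def powr_minus power_inverse divide_inverse)
  qed
  define P where "P k \<omega> = V_stat T (\<lambda>t. B t \<omega>) (2 ^ k) - \<tau> * q ^ k" for k \<omega>
  define Q where "Q k \<omega> = V_stat T (\<lambda>t. W t \<omega>) (2 ^ k) - T" for k \<omega>
  define R where "R k \<omega> = (\<Sum>i<2 ^ k. increment T (\<lambda>t. B t \<omega>) (2 ^ k) i
    * increment T (\<lambda>t. W t \<omega>) (2 ^ k) i)" for k \<omega>
  define e where "e \<omega> k = a\<^sup>2 * P k \<omega> + b\<^sup>2 * Q k \<omega> + 2 * a * b * R k \<omega>" for \<omega> k
  have V: "V_stat T (mixed_path a b B W \<omega>) (2 ^ k) = (a\<^sup>2 * \<tau>) * q ^ k + b\<^sup>2 * T + e \<omega> k" for \<omega> k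
  proof -
    have "increment T (mixed_path a b B W \<omega>) m i =
        a * increment T (\<lambda>t. B t \<omega>) m i + b * increment T (\<lambda>t. W t \<omega>) m i" for m i
      by (simp add: increment_def mixed_path_def algebra_simps)
    then have "V_stat T (mixed_path a b B W \<omega>) (2 ^ k) =
        a\<^sup>2 * V_stat T (\<lambda>t. B t \<omega>) (2 ^ k) + b\<^sup>2 * V_stat T (\<lambda>t. W t \<omega>) (2 ^ k) + 2 * a * b * R k \<omega>"
      by (simp add: V_stat_def R_def power2_sum power_mult_distrib sum.distrib sum_distrib_left mult_ac)
    then show ?thesis by (simp add: e_def P_def Q_def algebra_simps)
  qed
  have P2: "integrable M (\<lambda>\<omega>. P k \<omega> ^ 2)"
      "expectation (\<lambda>\<omega>. P k \<omega> ^ 2) \<le> 4 * \<tau>\<^sup>2 * (2 * s\<^sup>2) ^ k" if "H < 1/2" for k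
  proof -
    have eq: "real (2 ^ k) * (\<tau> * s ^ k) = \<tau> * q ^ k" by (simp add: qs power_mult_distrib)
    have "H \<le> 1/2" "0 < (2 :: nat) ^ k" using that by simp_all
    note m = fbm_quadratic_variation_second_moment[OF assms(5,2) this, unfolded scale eq, folded P_def]
    show "integrable M (\<lambda>\<omega>. P k \<omega> ^ 2)" using m(1) by simp
    have "4 * real (2 ^ k) * (\<tau> * s ^ k)\<^sup>2 = 4 * \<tau>\<^sup>2 * (2 * s\<^sup>2) ^ k"
      by (simp add: power_mult_distrib flip: power_mult) (simp add: mult.commute)
    then show "expectation (\<lambda>\<omega>. P k \<omega> ^ 2) \<le> 4 * \<tau>\<^sup>2 * (2 * s\<^sup>2) ^ k"
      using m(2) by (simp only:)
  qed
  have Q: "AE \<omega> in M. (\<lambda>k. real k * Q k \<omega>) \<longlonglongrightarrow> 0"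
    using wiener_quadratic_variation_second_moment[OF assms(6,2)]
    by (intro AE_tendsto_zero_of_geometric_second_moment[where C = "2 * T\<^sup>2" and \<theta> = "1 / 2"])
      (simp_all add: Q_def power_divide)
  have R: "AE \<omega> in M. (\<lambda>k. real k * R k \<omega>) \<longlonglongrightarrow> 0" if "H > 0"
  proof (rule AE_tendsto_zero_of_geometric_second_moment[where C = "T * \<tau>" and \<theta> = s])
    note m = cross_variation_second_moment[OF assms(5-7,2), of "2 ^ k" for k, unfolded scale, folded R_def]
    show "integrable M (\<lambda>\<omega>. R k \<omega> ^ 2)" "expectation (\<lambda>\<omega>. R k \<omega> ^ 2) \<le> T * \<tau> * s ^ k" for k
      using m[of k] by simp_all
    show "s < 1" using that powr_less_mono[of "- (2 * H)" 0 2] by (simp add: s_def)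
  qed (use s in simp)
  have q1: "q > 1" if "H < 1/2"
    using that powr_less_mono[of 0 "1 - 2 * H" 2] by (simp add: q_def)
  have A: "a\<^sup>2 * \<tau> > 0" using assms(3) \<tau> by simp
  show ?thesis
  proof (intro conjI impI)
    assume H: "H \<in> {0<..<1/2}"
    have "AE \<omega> in M. (\<lambda>k. real k * (P k \<omega> / q ^ k)) \<longlonglongrightarrow> 0"
    \<comment> \<open>After division by \<open>q^k\<close> the rate \<open>2 * s^2\<close> becomes
      \<open>2 * s^2 / (2 * s)^2 = 1/2\<close>, whatever the value of \<open>H\<close>.\<close>
    proof (rule AE_tendsto_zero_of_geometric_second_moment[where C = "4 * \<tau>\<^sup>2" and \<theta> = "1 / 2"])
      fix k
      show "integrable M (\<lambda>\<omega>. (P k \<omega> / q ^ k) ^ 2)"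
        using P2(1) H by (simp add: power_divide)
      have "expectation (\<lambda>\<omega>. (P k \<omega> / q ^ k) ^ 2) \<le> 4 * \<tau>\<^sup>2 * (2 * s\<^sup>2) ^ k / (q ^ k)\<^sup>2"
        using P2(2)[of k] H by (simp add: power_divide divide_right_mono)
      also have "\<dots> = 4 * \<tau>\<^sup>2 * ((2 * s\<^sup>2) / q\<^sup>2) ^ k"
        by (simp add: power_divide flip: power_mult) (simp add: mult.commute)
      also have "(2 * s\<^sup>2) / q\<^sup>2 = 1 / 2" using s by (simp add: qs power2_eq_square)
      finally show "expectation (\<lambda>\<omega>. (P k \<omega> / q ^ k) ^ 2) \<le> 4 * \<tau>\<^sup>2 * (1 / 2) ^ k" .
    qed auto
    moreover have "AE \<omega> in M. (\<lambda>k. real k * R k \<omega>) \<longlonglongrightarrow> 0" using R H by simp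
    ultimately show "AE \<omega> in M. (\<lambda>k. a_sq_est T (mixed_path a b B W \<omega>) k) \<longlonglongrightarrow> a\<^sup>2"
      using Q
    proof eventually_elim
      case (elim \<omega>)
      have q: "q > 1" using q1 H by simp
      then have qk: "(\<lambda>k. (1 / q) ^ k) \<longlonglongrightarrow> 0" by (intro LIMSEQ_realpow_zero) auto
      have "(\<lambda>k. a\<^sup>2 * (real k * (P k \<omega> / q ^ k)) + (b\<^sup>2 * (real k * Q k \<omega>)
          + 2 * a * b * (real k * R k \<omega>)) * (1 / q) ^ k) \<longlonglongrightarrow> a\<^sup>2 * 0 + (b\<^sup>2 * 0 + 2 * a * b * 0) * 0"
        by (intro tendsto_intros elim qk)
      then have "(\<lambda>k. real k * (e \<omega> k / q ^ k)) \<longlonglongrightarrow> 0"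
        using q by (simp add: e_def field_simps power_divide)
      from a_sq_est_tendsto[OF assms(2) A q V this]
      \<comment> \<open>Here \<open>log 2 q - 1 = - 2 * H\<close>, so the power of \<open>T\<close>
        in the limit cancels \<open>\<tau>\<close>.\<close>
      show ?case using assms(2) by (simp add: q_def \<tau>_def log_powr mult.assoc flip: powr_add)
    qed
  next
    assume H: "H \<in> {1/4<..<1/2}"
    have "AE \<omega> in M. (\<lambda>k. real k * P k \<omega>) \<longlonglongrightarrow> 0"
    \<comment> \<open>Without normalisation the rate is \<open>2 * s^2 = 2 powr (1 - 4 * H)\<close>,
      which is below 1 exactly when \<open>H > 1/4\<close>.\<close>
    proof (rule AE_tendsto_zero_of_geometric_second_moment[where C = "4 * \<tau>\<^sup>2" and \<theta> = "2 * s\<^sup>2"])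
      show "integrable M (\<lambda>\<omega>. P k \<omega> ^ 2)"
          "expectation (\<lambda>\<omega>. P k \<omega> ^ 2) \<le> 4 * \<tau>\<^sup>2 * (2 * s\<^sup>2) ^ k" for k
        using P2 H by simp_all
      have "2 * s\<^sup>2 = 2 powr (1 - 4 * H)"
        by (simp add: s_def power2_eq_square powr_diff powr_minus divide_simps flip: powr_add)
      also have "\<dots> < 1" using H powr_less_mono[of "1 - 4 * H" 0 2] by simp
      finally show "2 * s\<^sup>2 < 1" .
    qed auto
    moreover have "AE \<omega> in M. (\<lambda>k. real k * R k \<omega>) \<longlonglongrightarrow> 0" using R H by simp
    ultimately show "AE \<omega> in M. (\<lambda>k. b_sq_est T (mixed_path a b B W \<omega>) k) \<longlonglongrightarrow> b\<^sup>2"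
      using Q
    proof eventually_elim
      case (elim \<omega>)
      note lim = elim[THEN tendsto_of_linear_tendsto]
      have "(\<lambda>k. a\<^sup>2 * P k \<omega> + b\<^sup>2 * Q k \<omega> + 2 * a * b * R k \<omega>) \<longlonglongrightarrow> a\<^sup>2 * 0 + b\<^sup>2 * 0 + 2 * a * b * 0"
        by (intro tendsto_intros lim)
      then have "e \<omega> \<longlonglongrightarrow> 0" by (simp add: e_def[abs_def])
      from b_sq_est_tendsto[OF assms(2) A _ V this] q1 H
      show ?case using assms(2) by simp
    qed
  qed
qed

end
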